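(* Let $f$ be a conical combination (nonnegative real coefficients) of layered permutations. Then \[ \lim_{n\to\infty}\mathfrak{U}_{n,f}=p''(f). \]
   Context: $\mathfrak{S}_n$ is the set of permutations of $[n]$. For $\tau\in\mathfrak{S}_m$, $\sigma\in\mathfrak{S}_n$, $p(\tau,\sigma)$ is $\binom{n}{m}^{-1}$ times the number of $m$-subsets $\{i_1<\cdots<i_m\}\subset[n]$ such that $(\sigma(i_1),\ldots,\sigma(i_m))$ has the same relative order as $\tau$ (and $0$ if $m>n$), extended linearly to formal linear combinations in the first argument. A permutation is layered with layer sequence $(r_1,\ldots,r_k)$ if it is the concatenation of decreasing runs of consecutive values of lengths $r_1,\ldots,r_k$, each run's values below all later runs' values. $p''(f)=\lim_{N\to\infty}\min\{p(f,\sigma):\sigma\in\mathfrak{S}_N\text{ layered}\}$. For a layered $\tau\in\mathfrak{S}_m$ with layer sequence $(\ell_1,\ldots,\ell_k)$, the Price Polynomial of order $n$ is $q_{n,\tau}(x_1,\ldots,x_n)=m!\sum_{\{i_1<\cdots<i_k\}\subset[n]}\prod_{j=1}^k x_{i_j}^{\ell_j}/\ell_j!$ (empty sum $=0$), extended linearly to $q_{n,f}$. The Minimization Price Bound is $\mathfrak{U}_{n,f}=\min\{q_{n,f}(x_1,\ldots,x_n):\sum_j x_j=1,\ x_j\ge0\ \forall j\in[n]\}$. *)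

theory Defs
  imports Complex_Main "HOL-Library.Poly_Mapping" "HOL-Combinatorics.Multiset_Permutations"
begin

text \<open>
  Permutations of \<open>{1..n}\<close> are written in one-line notation, as the words
  \<open>[\<sigma>(1), \<dots>, \<sigma>(n)]\<close>; the size of a permutation is then the length of the word.
\<close>

definition perms :: "nat \<Rightarrow> nat list set" where
  "perms n = permutations_of_set {1..n}"

definition same_order :: "nat list \<Rightarrow> nat list \<Rightarrow> bool" where
  "same_order xs ys \<longleftrightarrow> length xs = length ys \<and>
     (\<forall>a<length xs. \<forall>b<length xs. xs ! a < xs ! b \<longleftrightarrow> ys ! a < ys ! b)"

text \<open>
  Position sets are 0-based here, as required by \<^const>\<open>nths\<close>.
  If \<open>length \<tau> > length \<sigma>\<close> the value is \<open>0 / 0 = 0\<close>.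
\<close>

definition density :: "nat list \<Rightarrow> nat list \<Rightarrow> real" where
  "density \<tau> \<sigma> =
     real (card {I. I \<subseteq> {..<length \<sigma>} \<and> card I = length \<tau> \<and> same_order (nths \<sigma> I) \<tau>})
       / real (length \<sigma> choose length \<tau>)"

text \<open>
  Formal real linear combinations of permutations (of possibly different sizes) are
  finitely supported functions.
\<close>

definition lin_density :: "(nat list \<Rightarrow>\<^sub>0 real) \<Rightarrow> nat list \<Rightarrow> real" where
  "lin_density f \<sigma> = (\<Sum>\<tau>\<in>Poly_Mapping.keys f. Poly_Mapping.lookup f \<tau> * density \<tau> \<sigma>)"

definition has_layers :: "nat list \<Rightarrow> nat list \<Rightarrow> bool" where
  "has_layers r \<sigma> \<longleftrightarrow> (\<exists>runs.
     \<sigma> = concat runs \<and> map length runs = r \<and>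
     (\<forall>w\<in>set runs. w \<noteq> [] \<and> (\<exists>a. w = rev [a..<a + length w])) \<and>
     sorted_wrt (\<lambda>v w. \<forall>x\<in>set v. \<forall>y\<in>set w. x < y) runs)"

definition layered :: "nat list \<Rightarrow> bool" where
  "layered \<sigma> \<longleftrightarrow> \<sigma> \<in> perms (length \<sigma>) \<and> (\<exists>r. has_layers r \<sigma>)"

text \<open>
  The layer sequence is unique: run boundaries are exactly the ascents.
\<close>

definition layer_seq :: "nat list \<Rightarrow> nat list" where
  "layer_seq \<tau> = (THE r. has_layers r \<tau>)"

definition min_layered_density :: "(nat list \<Rightarrow>\<^sub>0 real) \<Rightarrow> nat \<Rightarrow> real" where
  "min_layered_density f N = Min (lin_density f ` {\<sigma> \<in> perms N. layered \<sigma>})"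

text \<open>The quantity \<open>p''(f)\<close>.\<close>

definition p_layered :: "(nat list \<Rightarrow>\<^sub>0 real) \<Rightarrow> real" where
  "p_layered f = lim (min_layered_density f)"

text \<open>
  The polynomials \<open>q\<^sub>n\<^sub>,\<^sub>\<tau>\<close>, as functions of \<open>x 1, \<dots>, x n\<close>. The chosen indices
  \<open>i\<^sub>1 < \<dots> < i\<^sub>k\<close> are the entries of \<open>sorted_list_of_set S\<close>.
\<close>

definition price_poly :: "nat \<Rightarrow> nat list \<Rightarrow> (nat \<Rightarrow> real) \<Rightarrow> real" where
  "price_poly n \<tau> x = (let l = layer_seq \<tau>; k = length l in
     fact (length \<tau>) *
     (\<Sum>S | S \<subseteq> {1..n} \<and> card S = k.
        \<Prod>j<k. x (sorted_list_of_set S ! j) ^ (l ! j) / fact (l ! j)))"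

definition lin_price_poly :: "nat \<Rightarrow> (nat list \<Rightarrow>\<^sub>0 real) \<Rightarrow> (nat \<Rightarrow> real) \<Rightarrow> real" where
  "lin_price_poly n f x =
     (\<Sum>\<tau>\<in>Poly_Mapping.keys f. Poly_Mapping.lookup f \<tau> * price_poly n \<tau> x)"

text \<open>
  For \<open>n \<ge> 1\<close> the simplex is compact and nonempty, so the least value exists;
  for \<open>n = 0\<close> there is no admissible \<open>x\<close> and the value is unspecified.
\<close>

definition min_price_bound :: "nat \<Rightarrow> (nat list \<Rightarrow>\<^sub>0 real) \<Rightarrow> real" where
  "min_price_bound n f = (LEAST v. \<exists>x.
     (\<Sum>j=1..n. x j) = 1 \<and> (\<forall>j\<in>{1..n}. 0 \<le> x j) \<and> v = lin_price_poly n f x)"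

text \<open>Conical combinations of layered permutations.\<close>

definition conical_layered :: "(nat list \<Rightarrow>\<^sub>0 real) \<Rightarrow> bool" where
  "conical_layered f \<longleftrightarrow>
     (\<forall>\<tau>\<in>Poly_Mapping.keys f. layered \<tau> \<and> 0 \<le> Poly_Mapping.lookup f \<tau>)"

end

(* A pattern with layers l occurs in the layered permutation with layers r exactly
   sum over i_1 < ... < i_k of prod (r_(i_j) choose l_j) times. Choosing r multinomially with
   parameters N and x makes the expected density equal to the price polynomial at x, so the
   layered minimum for N is at most every price bound. Conversely, evaluating the price
   polynomial at x = r / N replaces binomials by powers, and Vandermonde's identity bounds
   the loss by 1 - m! (N choose m) / N^m, which tends to 0. *)
theory Submission
  imports Defs "HOL-Analysis.Function_Topology"
begin

section \<open>Sums over increasing index tuples\<close>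

text \<open>The first inequality holds with \<open>N\<close> (at least every pattern length) and
  \<open>n\<close> (positive) chosen independently. This is what gives convergence: the supremum of
  the layered minima over large \<open>N\<close> lies below every price bound, and the second
  inequality, used at \<open>n = N\<close>, squeezes both sequences onto that supremum. Order
  \<open>n = N\<close> is large enough because a permutation of size \<open>N\<close> has at most
  \<open>N\<close> layers. Pattern counts and price polynomials differ only in the weight of a used
  layer, \<open>r choose b\<close> against \<open>x ^ b / fact b\<close>. Hence one recursion with
  the weight as a parameter: the first layer is either skipped or matched with the first part.
  Vandermonde's identity and the binomial theorem are then parallel convolutions that can be
  compared term by term. Nonnegativity of the coefficients allows the loss to be estimated for each
  pattern separately.\<close>

fun esum :: "('a \<Rightarrow> nat \<Rightarrow> real) \<Rightarrow> 'a list \<Rightarrow> nat list \<Rightarrow> real" where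
  "esum w rs [] = 1"
| "esum w [] (b # l) = 0"
| "esum w (r # rs) (b # l) = esum w rs (b # l) + w r b * esum w rs l"

abbreviation choose_sum :: "nat list \<Rightarrow> nat list \<Rightarrow> real" where
  "choose_sum \<equiv> esum (\<lambda>r b. real (r choose b))"

abbreviation power_sum :: "real list \<Rightarrow> nat list \<Rightarrow> real" where
  "power_sum \<equiv> esum (\<lambda>x b. x ^ b / fact b)"

lemma power_sum_scale:
  "power_sum (map (\<lambda>x. x / c) xs) l = power_sum xs l / c ^ sum_list l"
  by (induction "\<lambda>(x::real) b::nat. x ^ b / fact b" xs l rule: esum.induct)
     (auto simp: power_divide power_add add_divide_distrib)

lemma choose_sum_nonneg: "0 \<le> choose_sum rs l"
  by (induction "\<lambda>(r::nat) b. real (r choose b)" rs l rule: esum.induct) auto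

text \<open>The recursion of \<open>esum\<close> takes either 0 or \<open>b\<close> points from the
  first layer. These are two terms of a full convolution, distinct because \<open>b\<close> is
  positive.\<close>

lemma two_terms_le_sum:
  fixes g :: "nat \<Rightarrow> real"
  assumes "\<And>j. j \<le> m \<Longrightarrow> 0 \<le> g j" "0 < b" "b \<le> m"
  shows "g 0 + g b \<le> sum g {..m}"
proof -
  have "sum g {0, b} \<le> sum g {..m}"
    using assms by (intro sum_mono2) auto
  then show ?thesis using assms by simp
qed

text \<open>Each counted choice is a set of \<open>sum_list l\<close> points in disjoint blocks. As
  the parts are positive, the set determines which blocks are used, so no set is counted
  twice.\<close>

lemma choose_sum_le:
  assumes "\<forall>b\<in>set l. 0 < b"
  shows "choose_sum rs l \<le> real (sum_list rs choose sum_list l)"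
  using assms
proof (induction "\<lambda>(r::nat) b. real (r choose b)" rs l rule: esum.induct)
  case (3 r rs b l)
  let ?s = "sum_list rs" and ?m = "b + sum_list l"
  let ?g = "\<lambda>j. real (r choose j) * real (?s choose (?m - j))"
  have "?g 0 + ?g b \<le> sum ?g {..?m}"
    using 3 by (intro two_terms_le_sum) auto
  also have "\<dots> = real ((r + ?s) choose ?m)"
    by (subst vandermonde[symmetric]) simp
  finally have "?g 0 + ?g b \<le> real ((r + ?s) choose ?m)" .
  moreover have "choose_sum rs (b # l) \<le> ?g 0" using 3 by simp
  moreover have "real (r choose b) * choose_sum rs l \<le> ?g b"
    using 3 by (simp add: mult_left_mono)
  ultimately show ?case by simp
qed auto

lemma choose_le_power_fact: "real (a choose j) \<le> real a ^ j / fact j"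
proof -
  have "real ((a choose j) * fact j) \<le> real (a ^ j)"
    using binomial_fact_pow of_nat_mono by blast
  then show ?thesis by (simp add: field_simps)
qed

text \<open>The binomial theorem in divided powers: it has the shape of Vandermonde's identity, so
  the two can be subtracted term by term.\<close>

lemma sum_power_fact:
  fixes x y :: real
  shows "(\<Sum>a\<le>n. x ^ a / fact a * (y ^ (n - a) / fact (n - a))) = (x + y) ^ n / fact n"
proof -
  have "(x + y) ^ n / fact n = (\<Sum>a\<le>n. real (n choose a) * x ^ a * y ^ (n - a) / fact n)"
    by (simp add: binomial_ring sum_divide_distrib)
  also have "\<dots> = (\<Sum>a\<le>n. x ^ a / fact a * (y ^ (n - a) / fact (n - a)))"
    by (intro sum.cong refl) (simp add: binomial_fact field_simps)
  finally show ?thesis by simp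
qed

text \<open>
  The defect on the left, summed over all sequences \<open>l\<close> with a given sum, would give the
  right-hand side exactly; each single defect is nonnegative.
\<close>

lemma power_sum_minus_choose_sum_le:
  assumes "\<forall>b\<in>set l. 0 < b"
  shows "power_sum (map real rs) l - choose_sum rs l
    \<le> real (sum_list rs) ^ sum_list l / fact (sum_list l) - real (sum_list rs choose sum_list l)"
  using assms
proof (induction "\<lambda>(r::nat) b. real (r choose b)" rs l rule: esum.induct)
  case (2 b l)
  then have "0 < sum_list (b # l)" by simp
  then show ?case by (simp add: zero_power binomial_eq_0)
next
  case (3 r rs b l)
  let ?s = "sum_list rs" and ?m = "b + sum_list l"
  let ?e = "\<lambda>(x::nat) j. real x ^ j / fact j"
  let ?g = "\<lambda>j. ?e r j * ?e ?s (?m - j) - real (r choose j) * real (?s choose (?m - j))"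
  have "?g 0 + ?g b \<le> sum ?g {..?m}"
  proof (rule two_terms_le_sum)
    fix j
    show "0 \<le> ?g j"
      using mult_mono[OF choose_le_power_fact[of r j] choose_le_power_fact[of ?s "?m - j"]]
      by simp
  qed (use 3 in auto)
  also have "\<dots> = real (r + ?s) ^ ?m / fact ?m - real ((r + ?s) choose ?m)"
    unfolding sum_subtractf sum_power_fact by (subst vandermonde[symmetric]) simp
  finally have *: "?g 0 + ?g b \<le> real (r + ?s) ^ ?m / fact ?m - real ((r + ?s) choose ?m)" .
  have 0: "power_sum (map real rs) (b # l) - choose_sum rs (b # l) \<le> ?g 0"
    using 3 by simp
  define P C where "P = power_sum (map real rs) l" and "C = choose_sum rs l"
  have IH: "P - C \<le> ?e ?s (sum_list l) - real (?s choose sum_list l)"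
    using 3 unfolding P_def C_def by simp
  have C: "C \<le> real (?s choose sum_list l)"
    using 3 unfolding C_def by (intro choose_sum_le) simp
  \<comment> \<open>The induction hypothesis is rearranged so that both sides are nonnegative
    differences; only then can it be multiplied by the bound on \<open>r choose b\<close>.\<close>
  have "real (r choose b) * (real (?s choose sum_list l) - C)
      \<le> ?e r b * (?e ?s (sum_list l) - P)"
    using IH C by (intro mult_mono choose_le_power_fact) auto
  then have "?e r b * P - real (r choose b) * C \<le> ?g b"
    by (simp add: algebra_simps)
  with * 0 show ?case unfolding P_def C_def by simp
qed simp

section \<open>Averaging over compositions\<close>

text \<open>For a probability vector this is the multinomial expectation divided by
  \<open>fact N\<close>. Without that normalization the weight is a product over the entries and the
  recursion needs no correction factors.\<close>

fun wsum :: "nat \<Rightarrow> real list \<Rightarrow> (nat list \<Rightarrow> real) \<Rightarrow> real" where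
  "wsum N [] g = (if N = 0 then g [] else 0)"
| "wsum N (x # xs) g = (\<Sum>a\<le>N. x ^ a / fact a * wsum (N - a) xs (\<lambda>r. g (a # r)))"

lemma wsum_add: "wsum N xs (\<lambda>r. g r + h r) = wsum N xs g + wsum N xs h"
  by (induction N xs g arbitrary: h rule: wsum.induct)
     (auto simp: sum.distrib distrib_left)

lemma wsum_mult: "wsum N xs (\<lambda>r. c * g r) = c * wsum N xs g"
  by (induction N xs g rule: wsum.induct) (auto simp: sum_distrib_left mult_ac)

lemma wsum_sum:
  "finite I \<Longrightarrow> wsum N xs (\<lambda>r. \<Sum>i\<in>I. g i r) = (\<Sum>i\<in>I. wsum N xs (g i))"
proof (induction I rule: finite_induct)
  case empty
  show ?case using wsum_mult[of N xs 0 "\<lambda>_. 0"] by simp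
qed (simp add: wsum_add)

lemma wsum_mono:
  assumes "\<And>r. sum_list r = N \<Longrightarrow> g r \<le> h r" "\<And>x. x \<in> set xs \<Longrightarrow> 0 \<le> x"
  shows "wsum N xs g \<le> wsum N xs h"
  using assms
proof (induction N xs g arbitrary: h rule: wsum.induct)
  case (2 N x xs g)
  show ?case unfolding wsum.simps
    by (intro sum_mono mult_left_mono 2(1)) (use 2(2,3) in auto)
qed auto

text \<open>A convolution of two shifted divided powers. The guards matter: truncated subtraction
  would otherwise turn out-of-range terms into 1.\<close>

lemma sum_power_fact_shift:
  fixes x y :: real
  shows "(\<Sum>a\<le>N. (if b \<le> a then x ^ (a - b) / fact (a - b) else 0) *
      (if c \<le> N - a then y ^ (N - a - c) / fact (N - a - c) else 0))
    = (if b + c \<le> N then (x + y) ^ (N - (b + c)) / fact (N - (b + c)) else 0)"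
proof (cases "b + c \<le> N")
  case True
  let ?f = "\<lambda>a. (if b \<le> a then x ^ (a - b) / fact (a - b) else 0) *
      (if c \<le> N - a then y ^ (N - a - c) / fact (N - a - c) else 0)"
  have "sum ?f {..N} = sum ?f {b..N - c}"
    using True by (intro sum.mono_neutral_right) auto
  also have "\<dots> = (\<Sum>a\<le>N - (b + c). x ^ a / fact a * (y ^ (N - (b + c) - a) / fact (N - (b + c) - a)))"
    using True
    by (intro sum.reindex_bij_witness[of _ "\<lambda>a. a + b" "\<lambda>a. a - b"]) (auto simp: add.commute)
  finally show ?thesis unfolding sum_power_fact using True by simp
next
  case False
  then show ?thesis by (auto intro!: sum.neutral)
qed

lemma power_fact_mult_choose:
  fixes x :: real
  shows "x ^ a / fact a * real (a choose b)
    = x ^ b / fact b * (if b \<le> a then x ^ (a - b) / fact (a - b) else 0)"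
proof (cases "b \<le> a")
  case True
  then show ?thesis
    by (simp add: binomial_fact power_add[symmetric])
qed simp

text \<open>Factorial moments of a multinomial vector: choosing \<open>b\<close> out of
  \<open>a\<close> units splits \<open>x ^ a / fact a\<close> into \<open>x ^ b / fact b\<close> and
  the weight of the other \<open>a - b\<close> units. The units left over after all choices spread
  freely over all entries, and the binomial theorem sums them up.\<close>

lemma wsum_choose_sum:
  "wsum N xs (\<lambda>r. choose_sum r l) = power_sum xs l *
    (if sum_list l \<le> N then sum_list xs ^ (N - sum_list l) / fact (N - sum_list l) else 0)"
proof (induction xs arbitrary: N l)
  case Nil
  show ?case by (cases l) (auto simp: power_0_left)
next
  case (Cons x xs)
  \<comment> \<open>The total weight of spreading the \<open>k - c\<close> unchosen units over the
    tail.\<close>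
  define T where "T c k = (if c \<le> k then sum_list xs ^ (k - c) / fact (k - c) else 0)" for c k
  have conv: "(\<Sum>a\<le>N. (if b \<le> a then x ^ (a - b) / fact (a - b) else 0) * T c (N - a))
      = (if b + c \<le> N then (x + sum_list xs) ^ (N - (b + c)) / fact (N - (b + c)) else 0)" for b c
    unfolding T_def by (rule sum_power_fact_shift)
  have IH: "wsum k xs (\<lambda>r. choose_sum r l) = power_sum xs l * T (sum_list l) k" for k l
    unfolding T_def by (rule Cons)
  have first: "(\<Sum>a\<le>N. x ^ a / fact a * (power_sum xs l * T c (N - a))) = power_sum xs l *
      (if c \<le> N then (x + sum_list xs) ^ (N - c) / fact (N - c) else 0)" for l c
  proof -
    \<comment> \<open>A skipped first entry is the shift by 0, written out so that
      \<open>conv\<close> applies.\<close>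
    have "(\<Sum>a\<le>N. x ^ a / fact a * (power_sum xs l * T c (N - a)))
      = power_sum xs l * (\<Sum>a\<le>N. (if 0 \<le> a then x ^ (a - 0) / fact (a - 0) else 0) * T c (N - a))"
      unfolding sum_distrib_left by (intro sum.cong) (auto simp: mult_ac)
    then show ?thesis unfolding conv by simp
  qed
  show ?case
  proof (cases l)
    case Nil
    then show ?thesis using IH[of _ "[]"] first[of "[]" 0] by simp
  next
    case [simp]: (Cons b l')
    have "wsum N (x # xs) (\<lambda>r. choose_sum r l)
      = (\<Sum>a\<le>N. x ^ a / fact a * (power_sum xs l * T (sum_list l) (N - a)))
       + (\<Sum>a\<le>N. (x ^ a / fact a * real (a choose b)) * (power_sum xs l' * T (sum_list l') (N - a)))"
      by (simp add: wsum_add wsum_mult IH sum.distrib[symmetric] algebra_simps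
          del: esum.simps(1) sum_list.Cons)
    also have "(\<Sum>a\<le>N. (x ^ a / fact a * real (a choose b)) * (power_sum xs l' * T (sum_list l') (N - a)))
      = x ^ b / fact b * power_sum xs l' *
        (\<Sum>a\<le>N. (if b \<le> a then x ^ (a - b) / fact (a - b) else 0) * T (sum_list l') (N - a))"
      unfolding power_fact_mult_choose by (simp only: sum_distrib_left mult_ac)
    finally show ?thesis unfolding conv first by (simp add: algebra_simps)
  qed
qed

section \<open>Layered words\<close>

fun layered_word :: "nat \<Rightarrow> nat list \<Rightarrow> nat list" where
  "layered_word a [] = []"
| "layered_word a (r # rs) = rev [a..<a + r] @ layered_word (a + r) rs"

lemma length_layered_word [simp]: "length (layered_word a rs) = sum_list rs"
  by (induction a rs rule: layered_word.induct) auto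

lemma set_layered_word [simp]: "set (layered_word a rs) = {a..<a + sum_list rs}"
  by (induction a rs rule: layered_word.induct) auto

lemma distinct_layered_word [simp]: "distinct (layered_word a rs)"
  by (induction a rs rule: layered_word.induct) auto

lemma layered_word_append_zeros [simp]:
  "layered_word a (rs @ replicate k 0) = layered_word a rs"
proof (induction a rs rule: layered_word.induct)
  case (1 a)
  show ?case by (induction k) auto
qed auto

text \<open>The first entry is the top value of the first run and so reveals its length. This fails
  for zero lengths, which are invisible in the word.\<close>

lemma layered_word_inj:
  assumes "layered_word a rs = layered_word a ls" "\<forall>b\<in>set rs. 0 < b" "\<forall>b\<in>set ls. 0 < b"
  shows "rs = ls"
  using assms
proof (induction a rs arbitrary: ls rule: layered_word.induct)
  case (1 a)
  then show ?case by (cases ls) auto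
next
  case (2 a r rs)
  obtain b l where ls: "ls = b # l"
    using 2 by (cases ls) auto
  have hd: "hd (layered_word a (r # rs)) = a + r - 1" if "0 < r" for r rs
    using that by (simp add: hd_append hd_rev)
  moreover have "layered_word a (r # rs) = layered_word a (b # l)" "0 < r" "0 < b"
    using 2 ls by auto
  ultimately have "a + r - 1 = a + b - 1" by (metis)
  then have "r = b" using \<open>0 < r\<close> \<open>0 < b\<close> by simp
  then show ?case using 2 ls by auto
qed

lemma has_layers_layered_word: "has_layers (filter ((<) 0) rs) (layered_word a rs)"
proof (induction a rs rule: layered_word.induct)
  case (1 a)
  show ?case by (simp add: has_layers_def)
next
  case (2 a r rs)
  show ?case
  proof (cases "r = 0")
    case True
    then show ?thesis using 2 by simp
  next
    case False
    from 2 obtain runs where runs: "layered_word (a + r) rs = concat runs"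
      "map length runs = filter ((<) 0) rs"
      "\<forall>w\<in>set runs. w \<noteq> [] \<and> (\<exists>a. w = rev [a..<a + length w])"
      "sorted_wrt (\<lambda>v w. \<forall>x\<in>set v. \<forall>y\<in>set w. x < y) runs"
      unfolding has_layers_def by blast
    have "\<forall>w\<in>set runs. \<forall>y\<in>set w. a + r \<le> y"
      using arg_cong[OF runs(1), of set] by fastforce
    then have "\<forall>v\<in>set runs. \<forall>x\<in>set (rev [a..<a + r]). \<forall>y\<in>set v. x < y"
      by fastforce
    moreover have "\<exists>c. rev [a..<a + r] = rev [c..<c + length (rev [a..<a + r])]"
      by (intro exI[of _ a]) simp
    ultimately show ?thesis unfolding has_layers_def using runs False
      by (intro exI[of _ "rev [a..<a + r] # runs"]) simp
  qed
qed

lemma layered_word_in_perms [simp]: "layered_word (Suc 0) rs \<in> perms (sum_list rs)"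
  unfolding perms_def by (rule permutations_of_setI) auto

lemma layered_layered_word [simp]: "layered (layered_word (Suc 0) rs)"
  unfolding layered_def using has_layers_layered_word[of rs "Suc 0"] by auto

text \<open>The runs together fill an interval and the first run lies below all others, so it
  contains the minimum \<open>a\<close> and must start there; what remains is again an
  interval.\<close>

lemma concat_runs_eq_layered_word:
  assumes "set (concat runs) = {a..<b}"
    and "\<forall>w\<in>set runs. w \<noteq> [] \<and> (\<exists>a. w = rev [a..<a + length w])"
    and "sorted_wrt (\<lambda>v w. \<forall>x\<in>set v. \<forall>y\<in>set w. x < y) runs"
  shows "concat runs = layered_word a (map length runs)"
  using assms
proof (induction runs arbitrary: a)
  case (Cons w runs)
  from Cons.prems obtain c where c: "w = rev [c..<c + length w]" and ne: "w \<noteq> []"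
    by auto
  have sw: "set w = {c..<c + length w}" by (subst c) auto
  have un: "set w \<union> set (concat runs) = {a..<b}" using Cons.prems by simp
  have less: "x < y" if "x \<in> set w" "y \<in> set (concat runs)" for x y
    using Cons.prems that by auto
  have cw: "c \<in> set w" using sw ne by auto
  then have "c \<in> {a..<b}" using un by blast
  then have "a \<le> c" "a \<in> {a..<b}" by auto
  then have "a \<le> c" "a \<in> set w \<union> set (concat runs)" unfolding un by blast+
  moreover have "c \<le> a" if "a \<in> set w" using that sw by auto
  ultimately have [simp]: "c = a" using less[OF cw, of a] by fastforce
  have "set (concat runs) = {a + length w..<b}"
  proof -
    have "set (concat runs) \<subseteq> {a..<b} - set w" using un less by blast
    moreover have "{a..<b} - set w \<subseteq> set (concat runs)" using un by blast
    moreover have "{a..<b} - set w = {a + length w..<b}" unfolding sw by auto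
    ultimately show ?thesis by blast
  qed
  then have "concat runs = layered_word (a + length w) (map length runs)"
    using Cons by auto
  then show ?case using c by simp
qed simp

lemma has_layers_imp_layered_word:
  assumes "\<sigma> \<in> perms n" "has_layers r \<sigma>"
  shows "\<sigma> = layered_word (Suc 0) r \<and> (\<forall>b\<in>set r. 0 < b) \<and> sum_list r = n"
proof -
  from assms(2) obtain runs where runs: "\<sigma> = concat runs" "map length runs = r"
    "\<forall>w\<in>set runs. w \<noteq> [] \<and> (\<exists>a. w = rev [a..<a + length w])"
    "sorted_wrt (\<lambda>v w. \<forall>x\<in>set v. \<forall>y\<in>set w. x < y) runs"
    unfolding has_layers_def by blast
  have \<sigma>: "set \<sigma> = {Suc 0..<Suc n}" "length \<sigma> = n"
    using permutations_of_setD(1)[of \<sigma> "{1..n}"] length_finite_permutations_of_set[of \<sigma> "{1..n}"]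
      assms(1) unfolding perms_def by (auto simp only: atLeastLessThanSuc_atLeastAtMost One_nat_def
        card_atLeastAtMost diff_Suc_1)
  have "set (concat runs) = {Suc 0..<Suc n}" using \<sigma>(1) runs(1) by simp
  then have eq: "\<sigma> = layered_word (Suc 0) r"
    using concat_runs_eq_layered_word[OF _ runs(3,4)] runs(1,2) by simp
  moreover have "sum_list r = n"
    using \<sigma>(2) unfolding eq by simp
  moreover have "\<forall>b\<in>set r. 0 < b"
    using runs(2,3) by (metis (no_types, lifting) imageE length_greater_0_conv list.set_map)
  ultimately show ?thesis by blast
qed

lemma layer_seq_eq:
  assumes "\<sigma> \<in> perms n" "has_layers r \<sigma>"
  shows "layer_seq \<sigma> = r"
  unfolding layer_seq_def
  using assms has_layers_imp_layered_word layered_word_inj by (metis the_equality)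

lemma layered_obtain:
  assumes "layered \<tau>"
  shows "\<tau> = layered_word (Suc 0) (layer_seq \<tau>)" "\<forall>b\<in>set (layer_seq \<tau>). 0 < b"
    "sum_list (layer_seq \<tau>) = length \<tau>"
  using assms has_layers_imp_layered_word layer_seq_eq unfolding layered_def by metis+

section \<open>Counting patterns in layered words\<close>

text \<open>The size of \<open>I\<close> is left out because \<open>same_order\<close> already
  forces it; this keeps the splitting of \<open>I\<close> over an append simple.\<close>

definition occurrences :: "nat list \<Rightarrow> nat list \<Rightarrow> nat set set" where
  "occurrences \<tau> \<sigma> = {I. I \<subseteq> {..<length \<sigma>} \<and> same_order (nths \<sigma> I) \<tau>}"

lemma card_restrict_lessThan: "I \<subseteq> {..<n} \<Longrightarrow> card {i. i < n \<and> i \<in> I} = card I"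
  by (rule arg_cong[where f = card]) auto

lemma density_eq_occurrences:
  "density \<tau> \<sigma> = real (card (occurrences \<tau> \<sigma>)) / real (length \<sigma> choose length \<tau>)"
proof -
  have "{I. I \<subseteq> {..<length \<sigma>} \<and> card I = length \<tau> \<and> same_order (nths \<sigma> I) \<tau>} = occurrences \<tau> \<sigma>"
    unfolding occurrences_def
    by (auto simp: same_order_def length_nths card_restrict_lessThan)
  then show ?thesis unfolding density_def by simp
qed

text \<open>Comparisons inside the decreasing prefixes depend only on positions, and comparisons
  across the blocks come out the same on both sides, so only the suffixes matter.\<close>

lemma same_order_append:
  assumes "length u = length t"
    and "sorted_wrt (>) u" "sorted_wrt (>) t"
    and "\<forall>x\<in>set u. \<forall>y\<in>set v. x < y" "\<forall>x\<in>set t. \<forall>y\<in>set s. x < y"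
  shows "same_order (u @ v) (t @ s) \<longleftrightarrow> same_order v s"
proof
  assume *: "same_order (u @ v) (t @ s)"
  show "same_order v s"
    unfolding same_order_def
  proof (intro conjI allI impI)
    show "length v = length s" using * assms(1) by (simp add: same_order_def)
    fix a b assume "a < length v" "b < length v"
    then have "(u @ v) ! (length u + a) < (u @ v) ! (length u + b)
      \<longleftrightarrow> (t @ s) ! (length u + a) < (t @ s) ! (length u + b)"
      using * unfolding same_order_def by (metis add_less_cancel_left length_append)
    then show "v ! a < v ! b \<longleftrightarrow> s ! a < s ! b"
      using assms(1) by (metis nth_append_length_plus)
  qed
next
  assume *: "same_order v s"
  then have len: "length v = length s" by (simp add: same_order_def)
  have dec: "xs ! a < xs ! b \<longleftrightarrow> b < a"
    if "sorted_wrt (>) xs" "a < length xs" "b < length xs" for xs :: "nat list" and a b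
    using that sorted_wrt_nth_less[of "(>)" xs a b] sorted_wrt_nth_less[of "(>)" xs b a]
    by (cases a b rule: linorder_cases) auto
  show "same_order (u @ v) (t @ s)"
    unfolding same_order_def
  proof (intro conjI allI impI)
    show "length (u @ v) = length (t @ s)" using len assms(1) by simp
    fix a b assume ab: "a < length (u @ v)" "b < length (u @ v)"
    consider "a < length u" "b < length u" | "a < length u" "b \<ge> length u"
      | "a \<ge> length u" "b < length u" | "a \<ge> length u" "b \<ge> length u" by linarith
    then show "(u @ v) ! a < (u @ v) ! b \<longleftrightarrow> (t @ s) ! a < (t @ s) ! b"
    proof cases
      case 1
      then show ?thesis using dec assms by (simp add: nth_append)
    next
      case 2
      then have "u ! a < v ! (b - length u)" "t ! a < s ! (b - length u)"
        using assms ab len by auto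
      then show ?thesis using 2 assms(1) by (simp add: nth_append)
    next
      case 3
      then have "u ! b < v ! (a - length u)" "t ! b < s ! (a - length u)"
        using assms ab len by auto
      then show ?thesis using 3 assms(1) by (simp add: nth_append)
    next
      case 4
      then show ?thesis using * ab assms(1) by (auto simp: nth_append same_order_def)
    qed
  qed
qed

text \<open>If one prefix were shorter, the entry just after it would exceed the first entry in one
  word and be smaller than it in the other.\<close>

lemma same_order_append_length:
  assumes "same_order (u @ v) (t @ s)" "u \<noteq> []" "t \<noteq> []"
    and "sorted_wrt (>) u" "sorted_wrt (>) t"
    and "\<forall>x\<in>set u. \<forall>y\<in>set v. x < y" "\<forall>x\<in>set t. \<forall>y\<in>set s. x < y"
  shows "length u = length t"
proof (rule linorder_cases)
  have same: "(u @ v) ! 0 < (u @ v) ! b \<longleftrightarrow> (t @ s) ! 0 < (t @ s) ! b"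
    if "b < length (u @ v)" for b
    using assms that unfolding same_order_def by auto
  have len: "length u + length v = length t + length s"
    using assms(1) by (simp add: same_order_def)
  {
    assume less: "length u < length t"
    then have "v \<noteq> []" using len by auto
    then have "(u @ v) ! 0 < (u @ v) ! length u"
      using assms by (auto simp: nth_append)
    moreover have "t ! length u < t ! 0"
      using sorted_wrt_nth_less[OF assms(5), of 0 "length u"] assms less by auto
    ultimately show "length u = length t"
      using same[of "length u"] less \<open>v \<noteq> []\<close> by (simp add: nth_append split: if_splits)
  }
  {
    assume less: "length t < length u"
    then have "s \<noteq> []" using len by auto
    then have "(t @ s) ! 0 < (t @ s) ! length t"
      using assms by (auto simp: nth_append)
    moreover have "u ! length t < u ! 0"
      using sorted_wrt_nth_less[OF assms(4), of 0 "length t"] assms less by auto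
    ultimately show "length u = length t"
      using same[of "length t"] less \<open>s \<noteq> []\<close> by (simp add: nth_append split: if_splits)
  }
qed simp

lemma nths_cong_index:
  assumes "\<And>i. i < length xs \<Longrightarrow> i \<in> A \<longleftrightarrow> i \<in> B"
  shows "nths xs A = nths xs B"
  unfolding nths_def using assms
  by (intro arg_cong[where f = "map fst"] filter_cong) (auto simp: set_zip)

lemma nths_append_split:
  assumes "K \<subseteq> {..<length u}"
  shows "nths (u @ v) (K \<union> (+) (length u) ` J) = nths u K @ nths v J"
proof -
  have "nths u (K \<union> (+) (length u) ` J) = nths u K"
    by (rule nths_cong_index) auto
  moreover have "{j. j + length u \<in> K \<union> (+) (length u) ` J} = J"
    using assms by (auto simp: image_iff add.commute)
  ultimately show ?thesis unfolding nths_append by simp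
qed

lemma card_occurrences_append:
  "card (occurrences \<tau> (u @ v)) = card {(K, J). K \<subseteq> {..<length u} \<and> J \<subseteq> {..<length v} \<and>
    same_order (nths u K @ nths v J) \<tau>}" (is "_ = card ?P")
proof -
  let ?f = "\<lambda>(K, J). K \<union> (+) (length u) ` J"
  let ?g = "\<lambda>I. (I \<inter> {..<length u}, {j. length u + j \<in> I})"
  have "bij_betw ?f ?P (occurrences \<tau> (u @ v))"
  proof (rule bij_betw_byWitness[where f' = ?g])
    show "\<forall>p\<in>?P. ?g (?f p) = p" by auto
    have *: "?f (?g I) = I" for I
    proof -
      have "i \<in> (+) (length u) ` {j. length u + j \<in> I}" if "i \<in> I" "\<not> i < length u" for i
        using that by (intro image_eqI[of _ _ "i - length u"]) auto
      then show ?thesis by auto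
    qed
    then show "\<forall>I\<in>occurrences \<tau> (u @ v). ?f (?g I) = I" by blast
    show "?f ` ?P \<subseteq> occurrences \<tau> (u @ v)"
      by (auto simp: occurrences_def nths_append_split)
    have "?g I \<in> ?P" if "I \<in> occurrences \<tau> (u @ v)" for I
    proof -
      have "nths (u @ v) (?f (?g I)) = nths u (fst (?g I)) @ nths v (snd (?g I))"
        using nths_append_split[of "fst (?g I)" u v "snd (?g I)"] by simp
      then show ?thesis using that unfolding * by (auto simp: occurrences_def)
    qed
    then show "?g ` occurrences \<tau> (u @ v) \<subseteq> ?P" by blast
  qed
  then show ?thesis by (simp add: bij_betw_same_card)
qed

lemma sorted_wrt_nths: "sorted_wrt P xs \<Longrightarrow> sorted_wrt P (nths xs I)"
  by (induction xs arbitrary: I) (auto simp: nths_Cons dest: in_set_nthsD)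

text \<open>An occurrence that meets the lowest run \<open>u\<close> matches its part in
  \<open>u\<close> with exactly the first run of the pattern. So it either avoids \<open>u\<close>
  or takes \<open>b\<close> arbitrary positions there, which is the recursion of
  \<open>esum\<close>.\<close>

lemma card_occurrences_run:
  assumes u: "sorted_wrt (>) u" and uv: "\<forall>x\<in>set u. \<forall>y\<in>set v. x < y" and "0 < b"
  shows "card (occurrences (layered_word c (b # l)) (u @ v))
    = card (occurrences (layered_word c (b # l)) v)
      + (length u choose b) * card (occurrences (layered_word (c + b) l) v)"
proof -
  let ?t = "rev [c..<c + b]" and ?s = "layered_word (c + b) l"
  have t: "sorted_wrt (>) ?t" "?t \<noteq> []" "\<forall>x\<in>set ?t. \<forall>y\<in>set ?s. x < y" "length ?t = b"
    using \<open>0 < b\<close> by (auto simp: sorted_wrt_rev)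
  have len: "length (nths u K) = card K" if "K \<subseteq> {..<length u}" for K
    using that by (simp add: length_nths card_restrict_lessThan)
  let ?B = "{K. K \<subseteq> {..<length u} \<and> card K = b}"
  have "same_order (nths u K @ nths v J) (?t @ ?s)
      \<longleftrightarrow> K = {} \<and> same_order (nths v J) (?t @ ?s) \<or> card K = b \<and> same_order (nths v J) ?s"
    if K: "K \<subseteq> {..<length u}" for K J
  proof (cases "K = {}")
    case True
    then show ?thesis using \<open>0 < b\<close> by simp
  next
    case False
    have "finite K" using K finite_subset by blast
    then have ne: "nths u K \<noteq> []" using False len[OF K] by auto
    have lt: "\<forall>x\<in>set (nths u K). \<forall>y\<in>set (nths v J). x < y"
      using uv by (blast dest: in_set_nthsD)
    have "card K = b" if "same_order (nths u K @ nths v J) (?t @ ?s)"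
      using same_order_append_length[OF that ne t(2) sorted_wrt_nths[OF u] t(1) lt t(3)] len[OF K] t(4)
      by simp
    moreover have "same_order (nths u K @ nths v J) (?t @ ?s) \<longleftrightarrow> same_order (nths v J) ?s"
      if "card K = b"
      using that len[OF K] t(4)
      by (intro same_order_append[OF _ sorted_wrt_nths[OF u] t(1) lt t(3)]) simp
    ultimately show ?thesis using False by blast
  qed
  then have "{(K, J). K \<subseteq> {..<length u} \<and> J \<subseteq> {..<length v} \<and> same_order (nths u K @ nths v J) (?t @ ?s)}
     = {{}} \<times> occurrences (?t @ ?s) v \<union> ?B \<times> occurrences ?s v"
    unfolding occurrences_def by auto
  moreover have "finite (occurrences \<tau> v)" for \<tau>
    by (rule finite_subset[of _ "Pow {..<length v}"]) (auto simp: occurrences_def)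
  moreover have "({{}} \<times> occurrences (?t @ ?s) v) \<inter> (?B \<times> occurrences ?s v) = {}"
    using \<open>0 < b\<close> by auto
  moreover have "finite ?B" by (rule finite_subset[of _ "Pow {..<length u}"]) auto
  moreover have "card ?B = length u choose b" using n_subsets[of "{..<length u}" b] by simp
  ultimately show ?thesis
    unfolding card_occurrences_append layered_word.simps
    by (simp add: card_Un_disjoint card_cartesian_product)
qed

lemma card_occurrences_layered_word:
  assumes "\<forall>b\<in>set l. 0 < b"
  shows "real (card (occurrences (layered_word c l) (layered_word a rs))) = choose_sum rs l"
  using assms
proof (induction "\<lambda>(r::nat) b. real (r choose b)" rs l arbitrary: a c rule: esum.induct)
  case (1 rs)
  have "occurrences [] (layered_word a rs) = {{}}"
    by (auto simp: occurrences_def same_order_def length_nths)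
  then show ?case by simp
next
  case (2 b l)
  have "occurrences (layered_word c (b # l)) [] = {}"
    using 2 by (auto simp: occurrences_def same_order_def)
  then show ?case by simp
next
  case (3 r rs b l)
  have "card (occurrences (layered_word c (b # l)) (layered_word a (r # rs)))
    = card (occurrences (layered_word c (b # l)) (layered_word (a + r) rs))
      + (r choose b) * card (occurrences (layered_word (c + b) l) (layered_word (a + r) rs))"
    using card_occurrences_run[of "rev [a..<a + r]" "layered_word (a + r) rs" b c l] 3(3)
    by (auto simp: sorted_wrt_rev)
  then show ?case using 3 by (simp del: layered_word.simps)
qed

lemma density_layered_word:
  assumes "layered \<tau>"
  shows "density \<tau> (layered_word (Suc 0) rs)
    = choose_sum rs (layer_seq \<tau>) / real (sum_list rs choose length \<tau>)"
  using card_occurrences_layered_word[OF layered_obtain(2)[OF assms], of "Suc 0" "Suc 0" rs]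
  by (simp add: density_eq_occurrences layered_obtain(1)[OF assms, symmetric])

section \<open>The price polynomial\<close>

text \<open>Subsets are split by whether they contain the smallest index \<open>a\<close>, which
  then heads the sorted list. A variable left endpoint lets the induction remove indices from the
  left.\<close>

lemma sum_subsets_eq_power_sum:
  "(\<Sum>S | S \<subseteq> {a..<a + n} \<and> card S = length l.
      \<Prod>j<length l. x (sorted_list_of_set S ! j) ^ (l ! j) / fact (l ! j))
    = power_sum (map x [a..<a + n]) l"
proof (induction n arbitrary: a l)
  case 0
  show ?case
  proof (cases l)
    case Nil
    have "{S. S \<subseteq> {a..<a + 0} \<and> card S = 0} = {{}}" by auto
    with Nil show ?thesis by simp
  next
    case (Cons b l')
    have "{S. S \<subseteq> {a..<a + 0} \<and> card S = length l} = {}" using Cons by auto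
    with Cons show ?thesis by simp
  qed
next
  case (Suc n)
  show ?case
  proof (cases l)
    case Nil
    have "finite S" if "S \<subseteq> {a..<a + Suc n}" for S using that finite_subset by blast
    then have "{S. S \<subseteq> {a..<a + Suc n} \<and> card S = 0} = {{}}" by auto
    with Nil show ?thesis by simp
  next
    case (Cons b l')
    let ?T = "{Suc a..<Suc a + n}"
    let ?w = "\<lambda>l S. \<Prod>j<length l. x (sorted_list_of_set S ! j) ^ (l ! j) / fact (l ! j)"
    let ?P = "\<lambda>l. {S. S \<subseteq> ?T \<and> card S = length l}"
    have fin: "finite S" if "S \<subseteq> ?T" for S using that finite_subset by blast
    have finP: "finite (?P l)" for l by (rule finite_subset[of _ "Pow ?T"]) auto
    have T: "{a..<a + Suc n} = insert a ?T" "a \<notin> ?T" by auto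
    have notin: "a \<notin> S" if "S \<subseteq> ?T" for S using that T(2) by blast
    have "{S. S \<subseteq> {a..<a + Suc n} \<and> card S = length l} = ?P l \<union> insert a ` ?P l'"
    proof (intro equalityI subsetI)
      fix S assume S: "S \<in> {S. S \<subseteq> {a..<a + Suc n} \<and> card S = length l}"
      show "S \<in> ?P l \<union> insert a ` ?P l'"
      proof (cases "a \<in> S")
        case True
        have "S - {a} \<subseteq> ?T" using S T by blast
        moreover have "card (S - {a}) = length l'" using True S Cons by (simp add: card_Diff_singleton)
        moreover have "S = insert a (S - {a})" using True by blast
        ultimately show ?thesis by blast
      next
        case False
        moreover have "S \<subseteq> insert a ?T" using S unfolding T(1) by blast
        ultimately have "S \<subseteq> ?T" by blast
        then show ?thesis using S by blast
      qed
    next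
      fix S assume "S \<in> ?P l \<union> insert a ` ?P l'"
      then show "S \<in> {S. S \<subseteq> {a..<a + Suc n} \<and> card S = length l}"
        unfolding T(1) using fin notin Cons by (auto simp: card_insert_if)
    qed
    moreover have "?P l \<inter> insert a ` ?P l' = {}" using T(2) by auto
    moreover have "sum (?w l) (insert a ` ?P l') = x a ^ b / fact b * sum (?w l') (?P l')"
    proof (subst sum.reindex)
      show "inj_on (insert a) (?P l')"
        using T(2) by (intro inj_onI) (metis (mono_tags) insert_ident mem_Collect_eq subsetD)
      have "?w l (insert a S) = x a ^ b / fact b * ?w l' S" if "S \<in> ?P l'" for S
      proof -
        have "a \<notin> S" "finite S" "\<forall>s\<in>S. a \<le> s" using that fin T(2) by auto
        then have "sorted_list_of_set (insert a S) = a # sorted_list_of_set S"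
          by (simp add: insort_is_Cons)
        then show ?thesis unfolding Cons by (simp add: prod.lessThan_Suc_shift del: prod.lessThan_Suc)
      qed
      then show "sum (?w l \<circ> insert a) (?P l') = x a ^ b / fact b * sum (?w l') (?P l')"
        unfolding sum_distrib_left by (intro sum.cong) auto
    qed
    moreover have "[a..<a + Suc n] = a # [Suc a..<Suc a + n]"
      by (simp add: upt_conv_Cons del: upt_Suc)
    ultimately show ?thesis
      using finP Suc[of l "Suc a"] Suc[of l' "Suc a"] Cons
      by (simp add: sum.union_disjoint del: upt_Suc)
  qed
qed

lemma price_poly_eq:
  "price_poly n \<tau> x = fact (length \<tau>) * power_sum (map x [1..<Suc n]) (layer_seq \<tau>)"
  using sum_subsets_eq_power_sum[where a = 1 and n = n and l = "layer_seq \<tau>" and x = x]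
  unfolding price_poly_def Let_def by (simp add: atLeastLessThanSuc_atLeastAtMost del: upt_Suc)

section \<open>Attainment of the minimum on the simplex\<close>

definition simplex :: "nat \<Rightarrow> (nat \<Rightarrow> real) set" where
  "simplex n = {x. (\<Sum>j=1..n. x j) = 1 \<and> (\<forall>j\<in>{1..n}. 0 \<le> x j)}"

lemma lin_price_poly_cong:
  assumes "\<And>j. j \<in> {1..n} \<Longrightarrow> x j = y j"
  shows "lin_price_poly n f x = lin_price_poly n f y"
proof -
  have "map x [1..<Suc n] = map y [1..<Suc n]"
    by (rule map_cong) (auto simp del: upt_Suc intro: assms)
  then show ?thesis unfolding lin_price_poly_def price_poly_eq by metis
qed

lemma continuous_on_lin_price_poly: "continuous_on A (lin_price_poly n f)"
  unfolding lin_price_poly_def price_poly_def Let_def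
  by (intro continuous_intros continuous_on_product_coordinates[THEN continuous_on_subset])
     auto

lemma lin_price_poly_attains_min:
  assumes "1 \<le> n"
  obtains x where "x \<in> simplex n" "\<And>y. y \<in> simplex n \<Longrightarrow> lin_price_poly n f x \<le> lin_price_poly n f y"
proof -
  \<comment> \<open>\<open>simplex n\<close> leaves the coordinates outside \<open>{1..n}\<close>
    free and is therefore not compact. Setting them to 0 gives a closed subset of a product of
    compact sets and does not change the values of the polynomial.\<close>
  define S where "S j = (if j \<in> {1..n} then {0..1} else {0::real})" for j
  define K where "K = PiE UNIV S \<inter> {x. (\<Sum>j=1..n. x j) = 1}"
  have "compactin (product_topology (\<lambda>_. euclidean) UNIV) (PiE UNIV S)"
    by (subst compactin_PiE) (auto simp: S_def)
  then have "compact (PiE UNIV S)" unfolding euclidean_product_topology by simp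
  moreover have "closed {x :: nat \<Rightarrow> real. (\<Sum>j=1..n. x j) = 1}"
    by (intro closed_Collect_eq continuous_intros continuous_on_product_coordinates)
  ultimately have "compact K" unfolding K_def by (rule compact_Int_closed)
  moreover have "(\<lambda>j. if j = 1 then 1 else 0) \<in> K"
    using assms by (auto simp: K_def S_def)
  ultimately obtain x where x: "x \<in> K" "\<forall>y\<in>K. lin_price_poly n f x \<le> lin_price_poly n f y"
    using continuous_attains_inf[OF _ _ continuous_on_lin_price_poly] by (metis empty_iff)
  show ?thesis
  proof
    have "0 \<le> x j" if "j \<in> {1..n}" for j
      using x(1) that by (auto simp: K_def S_def PiE_iff dest!: spec[of _ j])
    then show "x \<in> simplex n"
      using x(1) by (auto simp: K_def simplex_def)
    fix y assume y: "y \<in> simplex n"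
    let ?y = "\<lambda>j. if j \<in> {1..n} then y j else 0"
    have "y j \<le> 1" if "j \<in> {1..n}" for j
      using member_le_sum[of j "{1..n}" y] y that by (auto simp: simplex_def)
    then have "?y \<in> K" using y by (auto simp: K_def S_def simplex_def)
    then show "lin_price_poly n f x \<le> lin_price_poly n f y"
      using x(2) lin_price_poly_cong[of n ?y y f] by fastforce
  qed
qed

lemma min_price_bound_attained:
  assumes "1 \<le> n"
  obtains x where "x \<in> simplex n" "min_price_bound n f = lin_price_poly n f x"
    "\<And>y. y \<in> simplex n \<Longrightarrow> min_price_bound n f \<le> lin_price_poly n f y"
proof -
  obtain x where x: "x \<in> simplex n"
    "\<And>y. y \<in> simplex n \<Longrightarrow> lin_price_poly n f x \<le> lin_price_poly n f y"
    using lin_price_poly_attains_min[OF assms] by blast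
  have "min_price_bound n f = lin_price_poly n f x"
    unfolding min_price_bound_def
    by (rule Least_equality) (use x in \<open>auto simp: simplex_def\<close>)
  with x that show ?thesis by metis
qed

section \<open>Comparing the two minima\<close>

lemma finite_layered: "finite {\<sigma> \<in> perms N. layered \<sigma>}"
  by (simp add: perms_def)

lemma min_layered_density_le:
  "\<sigma> \<in> perms N \<Longrightarrow> layered \<sigma> \<Longrightarrow> min_layered_density f N \<le> lin_density f \<sigma>"
  unfolding min_layered_density_def using finite_layered by (intro Min_le) auto

lemma min_layered_density_attained:
  obtains \<sigma> where "\<sigma> \<in> perms N" "layered \<sigma>" "min_layered_density f N = lin_density f \<sigma>"
proof -
  have "layered_word (Suc 0) [N] \<in> {\<sigma> \<in> perms N. layered \<sigma>}"
    using layered_word_in_perms[of "[N]"] layered_layered_word[of "[N]"] by simp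
  then have "min_layered_density f N \<in> lin_density f ` {\<sigma> \<in> perms N. layered \<sigma>}"
    unfolding min_layered_density_def using finite_layered by (intro Min_in) blast+
  then show ?thesis using that by blast
qed

lemma lin_density_layered_word:
  assumes "conical_layered f"
  shows "lin_density f (layered_word (Suc 0) rs)
    = (\<Sum>\<tau>\<in>Poly_Mapping.keys f. Poly_Mapping.lookup f \<tau> / real (sum_list rs choose length \<tau>)
        * choose_sum rs (layer_seq \<tau>))"
  unfolding lin_density_def
  using assms by (intro sum.cong) (auto simp: density_layered_word conical_layered_def)

text \<open>
  A random layered permutation whose layer sizes are multinomial with parameters
  \<open>N\<close> and \<open>x\<close> has expected density exactly \<open>lin_price_poly n f x\<close>.
\<close>

lemma min_layered_density_le_lin_price_poly:
  assumes f: "conical_layered f" and x: "x \<in> simplex n"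
    and N: "\<forall>\<tau>\<in>Poly_Mapping.keys f. length \<tau> \<le> N"
  shows "min_layered_density f N \<le> lin_price_poly n f x"
proof -
  define xs where "xs = map x [1..<Suc n]"
  define c where "c = min_layered_density f N"
  have xs: "sum_list xs = 1" "\<And>y. y \<in> set xs \<Longrightarrow> 0 \<le> y"
    using x unfolding xs_def simplex_def
    by (auto simp: interv_sum_list_conv_sum_set_nat atLeastLessThanSuc_atLeastAtMost simp del: upt_Suc)
  have avg: "wsum N xs (\<lambda>r. choose_sum r l)
      = power_sum xs l * (if sum_list l \<le> N then 1 / fact (N - sum_list l) else 0)" for l
    unfolding wsum_choose_sum xs(1) by simp
  let ?K = "Poly_Mapping.keys f" and ?c = "Poly_Mapping.lookup f"
  let ?g = "\<lambda>r. \<Sum>\<tau>\<in>?K. ?c \<tau> / real (N choose length \<tau>) * choose_sum r (layer_seq \<tau>)"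
  \<comment> \<open>\<open>choose_sum r [] = 1\<close>, so the constant \<open>c\<close> is averaged
    by the same formula; the total weight is \<open>1 / fact N\<close>.\<close>
  have "c / fact N = wsum N xs (\<lambda>r. c * choose_sum r [])"
    unfolding wsum_mult avg by simp
  also have "\<dots> \<le> wsum N xs ?g"
  proof (rule wsum_mono)
    fix r :: "nat list" assume r: "sum_list r = N"
    have "c \<le> lin_density f (layered_word (Suc 0) r)"
      unfolding c_def using layered_word_in_perms[of r] r
      by (intro min_layered_density_le) auto
    then show "c * choose_sum r [] \<le> ?g r"
      unfolding lin_density_layered_word[OF f] r by simp
  qed (use xs in blast)
  also have "\<dots> = (\<Sum>\<tau>\<in>?K. ?c \<tau> * price_poly n \<tau> x / fact N)"
    unfolding wsum_sum[OF finite_keys] wsum_mult avg price_poly_eq xs_def[symmetric]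
  proof (intro sum.cong refl)
    \<comment> \<open>With \<open>m = length \<tau>\<close>, dividing
      \<open>1 / fact (N - m)\<close> by \<open>N choose m\<close> gives
      \<open>fact m / fact N\<close>, and \<open>fact m\<close> is the prefactor of the price
      polynomial.\<close>
    fix \<tau> assume "\<tau> \<in> ?K"
    then have "sum_list (layer_seq \<tau>) = length \<tau>" "length \<tau> \<le> N"
      using f N layered_obtain(3) by (auto simp: conical_layered_def)
    then show "?c \<tau> / real (N choose length \<tau>) * (power_sum xs (layer_seq \<tau>) *
        (if sum_list (layer_seq \<tau>) \<le> N then 1 / fact (N - sum_list (layer_seq \<tau>)) else 0))
      = ?c \<tau> * (fact (length \<tau>) * power_sum xs (layer_seq \<tau>)) / fact N"
      by (simp add: binomial_fact)
  qed
  also have "\<dots> = lin_price_poly n f x / fact N"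
    unfolding lin_price_poly_def by (simp add: sum_divide_distrib)
  finally show ?thesis unfolding c_def by (simp add: divide_le_cancel)
qed

text \<open>For positive \<open>N\<close>, the probability that \<open>m\<close> independent uniform
  draws from \<open>N\<close> points are not all distinct.\<close>

definition falling_defect :: "nat \<Rightarrow> nat \<Rightarrow> real" where
  "falling_defect N m = 1 - real (N choose m) * fact m / real N ^ m"

lemma falling_defect_tendsto_0: "(\<lambda>N. falling_defect N m) \<longlonglongrightarrow> 0"
proof -
  have "(\<lambda>N. real (N choose m) * fact m / real N ^ m) \<longlonglongrightarrow> 1"
  proof (induction m)
    case (Suc m)
    \<comment> \<open>The subtraction is real, so this also covers \<open>N \<le> m\<close>, where
      both sides vanish.\<close>
    have rec: "real (N choose Suc m) * fact (Suc m) = real (N choose m) * fact m * (real N - real m)" for N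
      using gbinomial_mult_1'[of "real N" m]
      by (simp add: binomial_gbinomial algebra_simps)
    have "(\<lambda>N. 1 - real m / real N) \<longlonglongrightarrow> 1 - 0"
      by (intro tendsto_intros lim_const_over_n)
    then have "(\<lambda>N. real (N choose m) * fact m / real N ^ m * (1 - real m / real N)) \<longlonglongrightarrow> 1"
      using tendsto_mult[OF Suc] by simp
    moreover have "\<forall>\<^sub>F N in sequentially. real (N choose m) * fact m / real N ^ m * (1 - real m / real N)
        = real (N choose Suc m) * fact (Suc m) / real N ^ Suc m"
      using eventually_gt_at_top[of 0]
      by eventually_elim (subst rec, simp add: field_simps)
    ultimately show ?case by (rule Lim_transform_eventually)
  qed simp
  from tendsto_diff[OF tendsto_const[of 1] this] show ?thesis
    unfolding falling_defect_def by simp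
qed

text \<open>Positive layers of total size \<open>N\<close> number at most \<open>N\<close>, so
  padding to length \<open>N\<close> is possible; it supplies exactly the \<open>N\<close> variables
  of the price polynomial of order \<open>N\<close>.\<close>

lemma layered_padded_obtain:
  assumes "\<sigma> \<in> perms N" "layered \<sigma>"
  obtains rs where "length rs = N" "sum_list rs = N" "\<sigma> = layered_word (Suc 0) rs"
proof -
  define r where "r = layer_seq \<sigma>"
  have len: "length \<sigma> = N"
    using length_finite_permutations_of_set assms(1) by (fastforce simp: perms_def)
  have r: "\<sigma> = layered_word (Suc 0) r" "\<forall>b\<in>set r. 0 < b" "sum_list r = N"
    using layered_obtain[OF assms(2)] len unfolding r_def by auto
  have "length r \<le> sum_list r" using r(2) by (induction r) auto
  then show ?thesis
    using r by (intro that[of "r @ replicate (N - length r) 0"]) (auto simp: sum_list_replicate)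
qed

text \<open>
  Take the normalized layer sizes of an optimal layered permutation, padded by zeros, as \<open>x\<close>.
\<close>

lemma min_price_bound_le:
  assumes f: "conical_layered f" and "1 \<le> N"
    and N: "\<forall>\<tau>\<in>Poly_Mapping.keys f. length \<tau> \<le> N"
  shows "min_price_bound N f \<le> min_layered_density f N
    + (\<Sum>\<tau>\<in>Poly_Mapping.keys f. Poly_Mapping.lookup f \<tau> * falling_defect N (length \<tau>))"
proof -
  obtain \<sigma> where \<sigma>: "\<sigma> \<in> perms N" "layered \<sigma>" "min_layered_density f N = lin_density f \<sigma>"
    by (rule min_layered_density_attained)
  obtain rs where rs: "length rs = N" "sum_list rs = N" "\<sigma> = layered_word (Suc 0) rs"
    by (rule layered_padded_obtain[OF \<sigma>(1,2)])
  \<comment> \<open>The variables of the polynomial start at index 1, the entries of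
    \<open>rs\<close> at 0.\<close>
  define x where "x j = real (rs ! (j - 1)) / real N" for j
  have map_x: "map x [1..<Suc N] = map (\<lambda>y. y / real N) (map real rs)"
    by (rule nth_equalityI) (auto simp: rs x_def simp del: upt_Suc)
  have "(\<Sum>j=1..N. x j) = sum_list (map x [1..<Suc N])"
    by (simp add: interv_sum_list_conv_sum_set_nat atLeastLessThanSuc_atLeastAtMost del: upt_Suc)
  also have "\<dots> = (\<Sum>r\<leftarrow>rs. real r) / real N"
    unfolding map_x by (simp add: comp_def divide_inverse sum_list_mult_const)
  also have "(\<Sum>r\<leftarrow>rs. real r) = real N"
    unfolding rs(2)[symmetric] by (induction rs) auto
  finally have "(\<Sum>j=1..N. x j) = 1" using \<open>1 \<le> N\<close> by simp
  then have "x \<in> simplex N" by (simp add: simplex_def x_def)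
  then have "min_price_bound N f \<le> lin_price_poly N f x"
    using min_price_bound_attained[OF \<open>1 \<le> N\<close>] by metis
  also have "\<dots> \<le> (\<Sum>\<tau>\<in>Poly_Mapping.keys f.
      Poly_Mapping.lookup f \<tau> * (density \<tau> \<sigma> + falling_defect N (length \<tau>)))"
    unfolding lin_price_poly_def
  proof (intro sum_mono mult_left_mono)
    fix \<tau> assume "\<tau> \<in> Poly_Mapping.keys f"
    then have \<tau>: "layered \<tau>" "0 \<le> Poly_Mapping.lookup f \<tau>" "length \<tau> \<le> N"
      using f N by (auto simp: conical_layered_def)
    then show "0 \<le> Poly_Mapping.lookup f \<tau>" by simp
    define l where "l = layer_seq \<tau>"
    define m where "m = length \<tau>"
    define A where "A = choose_sum rs l"
    have l: "\<forall>b\<in>set l. 0 < b" "sum_list l = m"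
      unfolding l_def m_def using layered_obtain[OF \<tau>(1)] by auto
    have pos: "0 < real (N choose m)" "0 < real N ^ m"
      using \<tau>(3) \<open>1 \<le> N\<close> by (auto simp: m_def)
    have "fact m * real (N choose m) \<le> real N ^ m"
      using choose_le_power_fact[of N m] by (simp add: field_simps)
    then have "fact m / real N ^ m \<le> 1 / real (N choose m)"
      using pos by (simp add: field_simps)
    then have A: "fact m / real N ^ m * A \<le> A / real (N choose m)"
      using mult_right_mono[of "fact m / real N ^ m" _ A] choose_sum_nonneg[of rs l]
      unfolding A_def by fastforce
    have "price_poly N \<tau> x = fact m / real N ^ m * power_sum (map real rs) l"
      unfolding price_poly_eq map_x power_sum_scale by (simp add: l_def[symmetric] m_def l(2)[unfolded m_def])
    \<comment> \<open>The Vandermonde loss bound; the factor \<open>fact m / real N ^ m\<close>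
      turns \<open>real N ^ m / fact m - real (N choose m)\<close> into
      \<open>falling_defect N m\<close>.\<close>
    also have "\<dots> \<le> fact m / real N ^ m * (A + (real N ^ m / fact m - real (N choose m)))"
      using power_sum_minus_choose_sum_le[OF l(1), of rs] rs(2) l(2)
      unfolding A_def by (intro mult_left_mono) auto
    also have "\<dots> = fact m / real N ^ m * A + falling_defect N m"
      using pos by (simp add: falling_defect_def field_simps)
    also have "\<dots> \<le> density \<tau> \<sigma> + falling_defect N m"
      using A unfolding rs(3) density_layered_word[OF \<tau>(1)] by (simp add: rs(2) A_def l_def m_def)
    finally show "price_poly N \<tau> x \<le> density \<tau> \<sigma> + falling_defect N (length \<tau>)"
      unfolding m_def .
  qed
  also have "\<dots> = min_layered_density f N
    + (\<Sum>\<tau>\<in>Poly_Mapping.keys f. Poly_Mapping.lookup f \<tau> * falling_defect N (length \<tau>))"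
    unfolding \<sigma>(3) lin_density_def by (simp add: distrib_left sum.distrib)
  finally show ?thesis .
qed

theorem mainTheorem8:
  fixes f :: "nat list \<Rightarrow>\<^sub>0 real"
  assumes "conical_layered f"
  shows "convergent (min_layered_density f) \<and>
    (\<lambda>n. min_price_bound n f) \<longlonglongrightarrow> p_layered f"
proof -
  let ?p = "min_layered_density f" and ?u = "\<lambda>n. min_price_bound n f"
  define e where "e N = (\<Sum>\<tau>\<in>Poly_Mapping.keys f. Poly_Mapping.lookup f \<tau> * falling_defect N (length \<tau>))" for N
  \<comment> \<open>\<open>insert 0\<close> keeps the maximum defined when \<open>f\<close> is zero;
    \<open>Suc\<close> excludes order 0, where the price bound is unspecified.\<close>
  define M where "M = Suc (Max (insert 0 (length ` Poly_Mapping.keys f)))"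
  have M: "\<forall>\<tau>\<in>Poly_Mapping.keys f. length \<tau> \<le> N" "1 \<le> N" if "M \<le> N" for N
  proof -
    have "length \<tau> \<le> Max (insert 0 (length ` Poly_Mapping.keys f))" if "\<tau> \<in> Poly_Mapping.keys f" for \<tau>
      using that by (intro Max_ge) auto
    then show "\<forall>\<tau>\<in>Poly_Mapping.keys f. length \<tau> \<le> N"
      using that unfolding M_def by (meson Suc_leD le_trans)
    show "1 \<le> N" using that unfolding M_def by simp
  qed
  have pu: "?p N \<le> ?u n" if "M \<le> N" "1 \<le> n" for N n
    using min_price_bound_attained[OF that(2), of f]
      min_layered_density_le_lin_price_poly[OF assms _ M(1)[OF that(1)]] by metis
  have up: "?u N \<le> ?p N + e N" if "M \<le> N" for N
    unfolding e_def by (rule min_price_bound_le[OF assms M(2,1)[OF that]])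
  \<comment> \<open>Any single price bound is an upper bound for these minima; order 1 serves to
    make the supremum meaningful.\<close>
  define L where "L = (SUP N\<in>{M..}. ?p N)"
  have pL: "?p N \<le> L" if "M \<le> N" for N
    unfolding L_def using that pu[of _ 1] by (intro cSUP_upper bdd_aboveI2[of _ _ "?u 1"]) auto
  have Lu: "L \<le> ?u N" if "M \<le> N" for N
    unfolding L_def using pu M(2)[OF that] by (intro cSUP_least) auto
  have ev: "\<forall>\<^sub>F N in sequentially. M \<le> N" by (rule eventually_ge_at_top)
  have "(\<lambda>N. L - e N) \<longlonglongrightarrow> L - 0" and "(\<lambda>N. L + e N) \<longlonglongrightarrow> L + 0"
    unfolding e_def
    by (intro tendsto_intros tendsto_null_sum tendsto_mult_right_zero falling_defect_tendsto_0)+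
  then have lims: "(\<lambda>N. L - e N) \<longlonglongrightarrow> L" "(\<lambda>N. L + e N) \<longlonglongrightarrow> L"
    by simp_all
  have "?p \<longlonglongrightarrow> L"
  proof (rule tendsto_sandwich[OF _ _ lims(1) tendsto_const])
    show "\<forall>\<^sub>F N in sequentially. L - e N \<le> ?p N"
      \<comment> \<open>Both bounds meet at order \<open>N\<close>:
        \<open>L \<le> ?u N \<le> ?p N + e N\<close>.\<close>
      using ev by eventually_elim (use Lu up in \<open>smt (verit)\<close>)
    show "\<forall>\<^sub>F N in sequentially. ?p N \<le> L"
      using ev by eventually_elim (rule pL)
  qed
  moreover have "?u \<longlonglongrightarrow> L"
  proof (rule tendsto_sandwich[OF _ _ tendsto_const lims(2)])
    show "\<forall>\<^sub>F N in sequentially. L \<le> ?u N"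
      using ev by eventually_elim (rule Lu)
    show "\<forall>\<^sub>F N in sequentially. ?u N \<le> L + e N"
      using ev by eventually_elim (use pL up in \<open>smt (verit)\<close>)
  qed
  ultimately show ?thesis
    unfolding p_layered_def by (auto simp: convergent_def limI)
qed

end
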